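(* Let $\Gamma$ be a tree and $\mu$ a probability measure on $V(\Gamma)$ whose weight function $M$ is totally defined. Then $|\mathbb{E}(\mu)|\le2$. Moreover, if $\mathbb{E}(\mu)=\{u,v\}$ (with $u\ne v$), then $u$ and $v$ are adjacent in $\Gamma$.
   Context: Let $d$ be the graph distance on $V(\Gamma)$. A probability measure $\mu$ on $V(\Gamma)$ is atomic: $\mu:V(\Gamma)\to[0,1]$ with $\sum_{s}\mu(s)=1$. Its weight function is $M(v)=\sum_{s\in V(\Gamma)}d^2(v,s)\mu(s)$, totally defined if $M(v)<\infty$ for all $v$. Its mean-set is $\mathbb{E}(\mu)=\{v\in V(\Gamma)\mid M(v)\le M(u)\ \forall u\in V(\Gamma)\}$. *)

theory Defs
  imports "HOL-Probability.Probability_Mass_Function" "Graph_Theory.Graph_Theory"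
begin

text \<open>
  A simple undirected graph, possibly infinite, is a symmetric loop-free digraph without parallel
  arcs: \<^locale>\<open>pair_bidirected_digraph\<close>. In such a digraph every edge gives a closed walk
  u, v, u, which \<^const>\<open>pre_digraph.cycle\<close> counts as a cycle, so \<^const>\<open>Digraph_Component.tree\<close> is
  not the undirected notion. The cycles of length at least 3 are exactly the undirected cycles.
\<close>

definition undirected_tree :: "'v pair_pre_digraph \<Rightarrow> bool" where
  "undirected_tree G \<longleftrightarrow>
     pair_bidirected_digraph G \<and> Digraph_Component.connected (with_proj G) \<and>
     \<not> (\<exists>p. pre_digraph.cycle (with_proj G) p \<and> length p \<ge> 3)"

text \<open>
  \<^const>\<open>wf_digraph.\<mu>\<close> is the least cost of a walk; with unit costs it is the graph distance.
  The conversion to real numbers maps infinity to 0, hence is meaningful only for connected graphs.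
\<close>

definition graph_dist :: "'v pair_pre_digraph \<Rightarrow> 'v \<Rightarrow> 'v \<Rightarrow> real" where
  "graph_dist G u v = real_of_ereal (wf_digraph.\<mu> (with_proj G) (\<lambda>_. 1) u v)"

text \<open>
  A probability measure on the vertices is a \<^type>\<open>pmf\<close> on the ambient type whose support lies
  in \<^term>\<open>pverts G\<close>.
\<close>

definition weight_fn :: "'v pair_pre_digraph \<Rightarrow> 'v pmf \<Rightarrow> 'v \<Rightarrow> ennreal" where
  "weight_fn G m v = (\<Sum>\<^sub>\<infinity>s\<in>pverts G. ennreal ((graph_dist G v s)\<^sup>2 * pmf m s))"

definition totally_defined :: "'v pair_pre_digraph \<Rightarrow> 'v pmf \<Rightarrow> bool" where
  "totally_defined G m \<longleftrightarrow> (\<forall>v\<in>pverts G. weight_fn G m v < \<infinity>)"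

definition mean_set :: "'v pair_pre_digraph \<Rightarrow> 'v pmf \<Rightarrow> 'v set" where
  "mean_set G m = {v \<in> pverts G. \<forall>u\<in>pverts G. weight_fn G m v \<le> weight_fn G m u}"

end

theory Submission
  imports Defs
begin

text \<open>
  The squared distance to a fixed vertex is strictly convex along paths of a tree, hence so is the
  weight function \<open>M\<close>, and a strictly convex sequence attains its minimum at no more than two
  indices, which are then consecutive.

  Only a local form of convexity is proved. Let \<open>x\<close> and \<open>z\<close> be distinct neighbours of \<open>y\<close>, and let
  \<open>s\<close> be any vertex at distance \<open>k\<close> from \<open>y\<close>. If neither \<open>x\<close> nor \<open>z\<close> were farther than \<open>k\<close> from
  \<open>s\<close>, shortest walks from both to \<open>s\<close> would miss \<open>y\<close>, and a path extracted from their union would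
  close to a cycle through \<open>y\<close>. So one of the two distances is \<open>k + 1\<close>; the other is at least \<open>\<bar>k - 1\<bar>\<close>, and
  \<open>(k + 1)\<^sup>2 + (k - 1)\<^sup>2 = 2 k\<^sup>2 + 2\<close>. Summing over \<open>s\<close> against the probability measure gives
  \<open>M x + M z > 2 M y\<close>, as \<open>M\<close> is finite (lemmas \<open>graph_dist_square_convex\<close> and \<open>weight_fn_strict_step\<close>).

  Consequently, once \<open>M\<close> fails to decrease along an edge of a path, it increases strictly along the
  rest of the path. A path of length at least two that starts at a minimiser of \<open>M\<close> therefore ends
  at a vertex of larger weight, so distinct minimisers are adjacent. Three minimisers would form a
  triangle, which a tree does not contain.
\<close>

section \<open>Graph distance as the length of a shortest walk\<close>

text \<open>
  The infimum defining the distance is attained although there may be infinitely many walks, because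
  lengths are natural numbers.
\<close>

lemma (in pair_wf_digraph) graph_dist_shortest_walk:
  assumes "u \<rightarrow>\<^sup>*\<^bsub>with_proj G\<^esub> v"
  obtains p where "awalk u p v" "graph_dist G u v = real (length p)"
    "\<And>q. awalk u q v \<Longrightarrow> length p \<le> length q"
proof -
  have cost: "awalk_cost (\<lambda>_. 1) p = real (length p)" for p
    by (induct p) auto
  have "\<exists>p. awalk u p v" using assms by (simp add: reachable_awalk)
  then obtain p where p: "awalk u p v"
      and least: "\<And>q. awalk u q v \<Longrightarrow> length p \<le> length q"
    using ex_has_least_nat[of "\<lambda>p. awalk u p v" _ length] by metis
  have "\<mu> (\<lambda>_. 1) u v = ereal (real (length p))"
    unfolding \<mu>_def cost
    by (rule antisym) (auto intro!: INF_lower2[of p] INF_greatest simp: p least)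
  then show thesis
    using p least that by (simp add: graph_dist_def)
qed

lemma (in pair_wf_digraph) graph_dist_le_length:
  assumes "awalk u p v"
  shows "graph_dist G u v \<le> real (length p)"
  using assms graph_dist_shortest_walk[of u v] by (metis of_nat_mono reachable_awalkI)

section \<open>Neighbours of a vertex in a tree\<close>

locale tree_graph = pair_bidirected_digraph +
  assumes connected: "Digraph_Component.connected (with_proj G)"
    and no_long_cycle: "pre_digraph.cycle (with_proj G) p \<Longrightarrow> length p < 3"

lemma undirected_tree_iff_tree_graph: "undirected_tree G \<longleftrightarrow> tree_graph G"
  unfolding undirected_tree_def tree_graph_def tree_graph_axioms_def
  by (auto simp: not_le)

context tree_graph
begin

lemma reachable_all:
  assumes "u \<in> pverts G" "v \<in> pverts G"
  shows "u \<rightarrow>\<^sup>*\<^bsub>with_proj G\<^esub> v"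
  using symmetric_connected_imp_strongly_connected[OF sym_arcs connected] assms
  by (auto simp: strongly_connected_def)

text \<open>
  A walk from \<open>x\<close> to \<open>z\<close> that misses \<open>y\<close> shortens to a path that misses \<open>y\<close>. It has at least one arc
  because \<open>x \<noteq> z\<close>, so the detour through \<open>y\<close> closes it to a cycle of length at least three.
\<close>

lemma neighbours_separated:
  assumes xy: "(x, y) \<in> parcs G" and zy: "(z, y) \<in> parcs G" and "x \<noteq> z"
    and p: "awalk x p z"
  shows "y \<in> set (awalk_verts x p)"
proof (rule ccontr)
  assume y: "y \<notin> set (awalk_verts x p)"
  define q where "q = awalk_to_apath p"
  have q: "apath x q z" and sub: "set q \<subseteq> set p"
    using p by (auto simp: q_def apath_awalk_to_apath awalk_to_apath_subset)
  have aq: "awalk x q z" and "q \<noteq> []"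
    using q \<open>x \<noteq> z\<close> by (auto simp: apath_def awalk_Nil_iff)
  have "y \<notin> set (awalk_verts x q)"
    using y sub unfolding set_awalk_verts[OF aq] set_awalk_verts[OF p] by auto
  moreover have walk: "awalk y ((y, x) # q @ [(z, y)]) y"
    using aq xy zy by (auto simp: awalk_Cons_iff awalk_Nil_iff arcs_symmetric
        dest: wellformed' intro!: awalk_appendI[of _ q z])
  moreover have "awalk_verts x (q @ [(z, y)]) = awalk_verts x q @ [y]"
    using aq zy by (subst awalk_verts_append[where v = y])
      (auto simp: awalk_Cons_iff awalk_Nil_iff dest: wellformed' intro!: awalk_appendI[of _ q z])
  ultimately have "cycle ((y, x) # q @ [(z, y)])"
    using q by (auto simp: cycle_def apath_def intro!: exI[of _ y])
  from no_long_cycle[OF this] \<open>q \<noteq> []\<close> show False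
    by (cases q) auto
qed

lemma no_triangle:
  assumes "(x, y) \<in> parcs G" "(z, y) \<in> parcs G" "(x, z) \<in> parcs G"
  shows False
proof -
  have "awalk x [(x, z)] z"
    using assms(3) by (auto simp: awalk_Cons_iff awalk_Nil_iff dest: wellformed')
  moreover have "x \<noteq> z" "x \<noteq> y" "z \<noteq> y"
    using assms by (auto dest: no_loops')
  ultimately show False
    using neighbours_separated[OF assms(1,2), of "[(x, z)]"] by auto
qed

text \<open>
  A shortest walk from \<open>x\<close> to \<open>s\<close> through \<open>y\<close> would leave a strictly shorter walk from \<open>y\<close> to \<open>s\<close>.
\<close>

lemma walk_avoiding:
  assumes "x \<in> pverts G" "s \<in> pverts G" "x \<noteq> y"
    and le: "graph_dist G x s \<le> graph_dist G y s"
  obtains p where "awalk x p s" "y \<notin> set (awalk_verts x p)"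
proof -
  obtain p where p: "awalk x p s" "graph_dist G x s = real (length p)"
    using graph_dist_shortest_walk[OF reachable_all[OF assms(1,2)]] by metis
  have "y \<notin> set (awalk_verts x p)"
  proof
    assume "y \<in> set (awalk_verts x p)"
    then obtain q r where "p = q @ r" "awalk x q y" "awalk y r s"
      using awalk_decomp[OF p(1)] by blast
    moreover from this \<open>x \<noteq> y\<close> have "0 < length q"
      by (auto simp: awalk_Nil_iff)
    ultimately show False
      using graph_dist_le_length[of y r s] le p(2) by (simp del: length_greater_0_conv)
  qed
  with p that show thesis by blast
qed

lemma one_neighbour_farther:
  assumes "(x, y) \<in> parcs G" "(z, y) \<in> parcs G" "x \<noteq> z" "s \<in> pverts G"
  shows "graph_dist G y s < graph_dist G x s \<or> graph_dist G y s < graph_dist G z s"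
proof (rule ccontr)
  assume "\<not> ?thesis"
  then have "graph_dist G x s \<le> graph_dist G y s" "graph_dist G z s \<le> graph_dist G y s"
    by auto
  moreover have "x \<noteq> y" "z \<noteq> y" "x \<in> pverts G" "z \<in> pverts G"
    using assms by (auto dest: no_loops' wellformed')
  ultimately obtain p q where p: "awalk x p s" "y \<notin> set (awalk_verts x p)"
      and q: "awalk z q s" "y \<notin> set (awalk_verts z q)"
    using walk_avoiding \<open>s \<in> pverts G\<close> by metis
  have q': "awalk s (rev_path q) z" "y \<notin> set (awalk_verts s (rev_path q))"
    using q by (auto simp: awalk_verts_rev_path)
  then have "awalk x (p @ rev_path q) z" "y \<notin> set (awalk_verts x (p @ rev_path q))"
    using p awalk_appendI[OF p(1) q'(1)] set_awalk_verts_append[OF p(1) q'(1)] by auto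
  then show False
    using neighbours_separated assms by metis
qed

lemma graph_dist_neighbour:
  assumes "(x, y) \<in> parcs G" "s \<in> pverts G"
  shows "graph_dist G x s \<le> graph_dist G y s + 1"
proof -
  have "y \<in> pverts G" using assms by (auto dest: wellformed')
  then obtain p where p: "awalk y p s" "graph_dist G y s = real (length p)"
    using graph_dist_shortest_walk[OF reachable_all] assms by metis
  then have "awalk x ((x, y) # p) s"
    using assms by (auto simp: awalk_Cons_iff)
  from graph_dist_le_length[OF this] p show ?thesis by simp
qed

lemma graph_dist_nat:
  assumes "u \<in> pverts G" "v \<in> pverts G"
  obtains n :: nat where "graph_dist G u v = real n"
  using graph_dist_shortest_walk[OF reachable_all[OF assms]] by metis

section \<open>Strict convexity of the weight function\<close>

lemma graph_dist_square_convex: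
  assumes xy: "(x, y) \<in> parcs G" and zy: "(z, y) \<in> parcs G" and "x \<noteq> z" and s: "s \<in> pverts G"
  shows "2 * (graph_dist G y s)\<^sup>2 + 2 \<le> (graph_dist G x s)\<^sup>2 + (graph_dist G z s)\<^sup>2"
proof -
  have *: "2 * (graph_dist G y s)\<^sup>2 + 2 \<le> (graph_dist G a s)\<^sup>2 + (graph_dist G b s)\<^sup>2"
    if a: "(a, y) \<in> parcs G" and b: "(b, y) \<in> parcs G"
      and far: "graph_dist G y s < graph_dist G b s" for a b
  proof -
    have "a \<in> pverts G" "b \<in> pverts G" "y \<in> pverts G"
      using a b by (auto dest: wellformed')
    then obtain k l n where dist: "graph_dist G y s = real k" "graph_dist G b s = real n"
        "graph_dist G a s = real l"
      using graph_dist_nat s by metis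
    have n: "real k + 1 \<le> real n" using far dist by simp
    have l: "\<bar>real k - 1\<bar> \<le> real l"
    proof (cases "k = 0")
      case True
      \<comment> \<open>Here \<open>s = y\<close>, so the bound says \<open>a \<noteq> s\<close>.\<close>
      obtain p where p: "awalk y p s" "graph_dist G y s = real (length p)"
        using graph_dist_shortest_walk[OF reachable_all[OF \<open>y \<in> _\<close> s]] by metis
      obtain q where q: "awalk a q s" "graph_dist G a s = real (length q)"
        using graph_dist_shortest_walk[OF reachable_all[OF \<open>a \<in> _\<close> s]] by metis
      have "q \<noteq> []"
        using p q dist True no_loops'[OF a] by (auto simp: awalk_Nil_iff)
      then show ?thesis using q dist True by (cases q) auto
    next
      case False
      then show ?thesis
        using graph_dist_neighbour[OF arcs_symmetric[OF a] s] dist by simp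
    qed
    have "(real k + 1)\<^sup>2 \<le> (real n)\<^sup>2"
      by (rule power_mono[OF n]) simp
    moreover have "(real k - 1)\<^sup>2 \<le> (real l)\<^sup>2"
      using power_mono[OF l, of 2] by simp
    ultimately show ?thesis
      using dist by (simp add: power2_eq_square algebra_simps)
  qed
  show ?thesis
    using one_neighbour_farther[OF assms] *[OF xy zy] *[OF zy xy] by auto
qed

text \<open>
  The weights are extended nonnegative reals, where subtraction misbehaves, so convexity is used
  in the additive form \<open>M y + M y + \<epsilon> \<le> M x + M z\<close>. Here \<open>\<epsilon>\<close> is the total mass of the measure; it
  is positive because the measure has an atom among the vertices, and this makes the convexity
  strict. Finiteness of \<open>M y\<close> then allows cancelling.
\<close>

lemma weight_fn_strict_step:
  assumes xy: "(x, y) \<in> parcs G" and zy: "(z, y) \<in> parcs G" and "x \<noteq> z"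
    and supp: "set_pmf m \<subseteq> pverts G" and fin: "weight_fn G m y < \<infinity>"
    and le: "weight_fn G m x \<le> weight_fn G m y"
  shows "weight_fn G m y < weight_fn G m z"
proof -
  define \<epsilon> where "\<epsilon> = (\<Sum>\<^sub>\<infinity>s\<in>pverts G. ennreal (pmf m s))"
  obtain s0 where s0: "s0 \<in> set_pmf m" using set_pmf_not_empty[of m] by blast
  have "ennreal (pmf m s0) = (\<Sum>\<^sub>\<infinity>s\<in>{s0}. ennreal (pmf m s))"
    by simp
  also have "\<dots> \<le> \<epsilon>"
    unfolding \<epsilon>_def using s0 supp by (intro infsum_mono_neutral nonneg_summable_on_complete) auto
  finally have \<epsilon>: "\<epsilon> > 0"
    using s0 by (metis ennreal_less_zero_iff less_le_trans pmf_positive)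
  have "weight_fn G m y + weight_fn G m y + \<epsilon> =
      (\<Sum>\<^sub>\<infinity>s\<in>pverts G. ennreal ((graph_dist G y s)\<^sup>2 * pmf m s)
        + ennreal ((graph_dist G y s)\<^sup>2 * pmf m s) + ennreal (pmf m s))"
    unfolding weight_fn_def \<epsilon>_def by (simp add: infsum_add nonneg_summable_on_complete)
  also have "\<dots> \<le> (\<Sum>\<^sub>\<infinity>s\<in>pverts G. ennreal ((graph_dist G x s)\<^sup>2 * pmf m s)
        + ennreal ((graph_dist G z s)\<^sup>2 * pmf m s))"
  proof (intro infsum_mono)
    fix s assume s: "s \<in> pverts G"
    have "(2 * (graph_dist G y s)\<^sup>2 + 1) * pmf m s
        \<le> ((graph_dist G x s)\<^sup>2 + (graph_dist G z s)\<^sup>2) * pmf m s"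
      using graph_dist_square_convex[OF xy zy \<open>x \<noteq> z\<close> s]
      by (intro mult_right_mono) auto
    then show "ennreal ((graph_dist G y s)\<^sup>2 * pmf m s)
        + ennreal ((graph_dist G y s)\<^sup>2 * pmf m s) + ennreal (pmf m s)
      \<le> ennreal ((graph_dist G x s)\<^sup>2 * pmf m s) + ennreal ((graph_dist G z s)\<^sup>2 * pmf m s)"
      by (simp add: ennreal_plus[symmetric] algebra_simps del: ennreal_plus)
  qed (simp_all add: nonneg_summable_on_complete)
  also have "\<dots> = weight_fn G m x + weight_fn G m z"
    unfolding weight_fn_def by (simp add: infsum_add nonneg_summable_on_complete)
  also have "\<dots> \<le> weight_fn G m y + weight_fn G m z"
    using le by (rule add_right_mono)
  finally have "weight_fn G m y + \<epsilon> \<le> weight_fn G m z"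
    using fin by (auto simp: add.assoc ennreal_add_left_cancel_le)
  moreover have "weight_fn G m y < weight_fn G m y + \<epsilon>"
    using fin \<epsilon> by (simp add: ennreal_add_left_cancel_less)
  ultimately show ?thesis by (rule less_le_trans[rotated])
qed

text \<open>
  Each strict step supplies the comparison of weights that the next step starts from.
\<close>

lemma weight_fn_increases_along_path:
  assumes supp: "set_pmf m \<subseteq> pverts G" and tot: "totally_defined G m"
    and "apath x ((x, y) # p) v" "p \<noteq> []" "weight_fn G m x \<le> weight_fn G m y"
  shows "weight_fn G m y < weight_fn G m v"
  using assms(3-)
proof (induct p arbitrary: x y)
  case (Cons e p)
  obtain z where e: "e = (y, z)"
    using Cons.prems(1) by (cases e) (auto simp: apath_def awalk_Cons_iff)
  have xy: "(x, y) \<in> parcs G" and yz: "(y, z) \<in> parcs G" and "x \<noteq> z"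
      and tail: "apath y ((y, z) # p) v"
    using Cons.prems(1) by (cases p; auto simp: e apath_def awalk_Cons_iff)+
  have "weight_fn G m y < \<infinity>"
    using tot xy by (auto simp: totally_defined_def dest: wellformed')
  then have step: "weight_fn G m y < weight_fn G m z"
    using weight_fn_strict_step[OF xy arcs_symmetric[OF yz] \<open>x \<noteq> z\<close> supp] Cons.prems(3) by simp
  show ?case
  proof (cases "p = []")
    case True
    then show ?thesis using step tail by (simp add: apath_def awalk_Cons_iff awalk_Nil_iff)
  next
    case False
    with Cons.hyps[OF tail False] step show ?thesis by (meson less_imp_le less_trans)
  qed
qed simp

section \<open>The mean-set\<close>

lemma mean_set_adjacent:
  assumes supp: "set_pmf m \<subseteq> pverts G" and tot: "totally_defined G m"
    and u: "u \<in> mean_set G m" and v: "v \<in> mean_set G m" and "u \<noteq> v"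
  shows "(u, v) \<in> parcs G"
proof -
  have "u \<rightarrow>\<^sup>*\<^bsub>with_proj G\<^esub> v"
    using u v by (intro reachable_all) (auto simp: mean_set_def)
  then obtain q where q: "apath u q v"
    by (auto simp: reachable_apath)
  with \<open>u \<noteq> v\<close> obtain x p where up: "q = (u, x) # p"
    by (cases q) (auto simp: apath_def awalk_Cons_iff awalk_Nil_iff)
  have ux: "(u, x) \<in> parcs G"
    using q by (auto simp: up apath_def awalk_Cons_iff)
  have "p = []"
  proof (rule ccontr)
    assume "p \<noteq> []"
    moreover have ux_le: "weight_fn G m u \<le> weight_fn G m x"
      using u ux by (auto simp: mean_set_def dest: wellformed')
    ultimately have "weight_fn G m x < weight_fn G m v"
      using weight_fn_increases_along_path[OF supp tot] q up by blast
    moreover have "weight_fn G m v \<le> weight_fn G m u"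
      using u v by (auto simp: mean_set_def)
    ultimately show False
      using ux_le by simp
  qed
  then show ?thesis
    using q ux by (simp add: up apath_def awalk_Cons_iff awalk_Nil_iff)
qed

end

theorem proposition5p8:
  fixes G :: "'v pair_pre_digraph" and m :: "'v pmf"
  assumes "undirected_tree G"
    and "set_pmf m \<subseteq> pverts G"
    and "totally_defined G m"
  shows "finite (mean_set G m) \<and> card (mean_set G m) \<le> 2 \<and>
    (\<forall>u v. u \<noteq> v \<longrightarrow> mean_set G m = {u, v} \<longrightarrow> (u, v) \<in> parcs G)"
proof -
  interpret tree_graph G
    using assms(1) by (simp add: undirected_tree_iff_tree_graph)
  note adj = mean_set_adjacent[OF assms(2,3)]
  have "\<exists>a b. mean_set G m \<subseteq> {a, b}"
  proof (rule ccontr)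
    assume more: "\<not> ?thesis"
    then obtain a where a: "a \<in> mean_set G m" by blast
    moreover from more obtain b where b: "b \<in> mean_set G m" "b \<noteq> a" by blast
    moreover from more obtain c where c: "c \<in> mean_set G m" "c \<noteq> a" "c \<noteq> b" by blast
    ultimately show False
      using no_triangle[of a b c] adj by metis
  qed
  then obtain a b where sub: "mean_set G m \<subseteq> {a, b}" by blast
  then have "finite (mean_set G m)" by (rule finite_subset) simp
  moreover have "card (mean_set G m) \<le> 2"
    using card_mono[OF _ sub] card_insert_le_m1[of 2 "{b}" a] by simp
  moreover have "\<forall>u v. u \<noteq> v \<longrightarrow> mean_set G m = {u, v} \<longrightarrow> (u, v) \<in> parcs G"
    using adj by blast
  ultimately show ?thesis by blast
qed

end
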